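(* Let $w$ be a universal Lyndon word of degree $n$, let $s$ be a word and $a\in\Sigma_n\setminus\mathrm{alp}(s)$ a letter such that $asa$ is a cyclic factor of $w$. Then $bsb$ is a cyclic factor of $w$ for every $b\in\Sigma_n\setminus\mathrm{alp}(s)$.
   Context: $\Sigma_n=\{1,\ldots,n\}$. For a word $w=a_1\cdots a_m$ a proper conjugate is $w_2w_1$ where $w=w_1w_2$ with $w_1,w_2$ nonempty. A total order on the alphabet induces the lexicographic order on words ($u$ is smaller than $v$ if $u$ is a proper prefix of $v$, or $u=zau'$, $v=zbv'$ with letters $a<b$). A word $w$ over $\Sigma_n$ is a Lyndon word if for some total order on $\Sigma_n$ it is strictly lexicographically smaller than each of its proper conjugates. A universal Lyndon word of degree $n$ is a word over $\Sigma_n$ of length $n!$ all of whose conjugates are Lyndon words. A cyclic factor of $w$ is a nonempty word $u$ with $|u|\le|w|$ that is a factor of $ww$. $\mathrm{alp}(s)$ is the set of letters occurring in $s$ (the word $s$ may be empty). *)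

theory Defs
  imports Main "HOL-Library.Sublist"
begin

definition alphabet :: "nat \<Rightarrow> nat set" where
  "alphabet n = {1..n}"

definition conjugates :: "'a list \<Rightarrow> 'a list set" where
  "conjugates w = {w2 @ w1 | w1 w2. w = w1 @ w2}"

(* As a word, a proper conjugate may coincide with w (namely if w is not primitive). *)
definition proper_conjugates :: "'a list \<Rightarrow> 'a list set" where
  "proper_conjugates w = {w2 @ w1 | w1 w2. w = w1 @ w2 \<and> w1 \<noteq> [] \<and> w2 \<noteq> []}"

(* The relation r is the strict part of a total order on the alphabet, and lexord r is then the
   strict lexicographic order on words, in which proper prefixes are smaller.  The inclusion
   is stated separately because strict_linear_order_on A r does not confine r to A. *)
definition lyndon :: "nat \<Rightarrow> nat list \<Rightarrow> bool" where
  "lyndon n w \<longleftrightarrow> w \<in> lists (alphabet n) \<and>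
     (\<exists>r. r \<subseteq> alphabet n \<times> alphabet n \<and> strict_linear_order_on (alphabet n) r \<and>
          (\<forall>v \<in> proper_conjugates w. (w, v) \<in> lexord r))"

(* The total order witnessing that a conjugate is Lyndon may depend on the conjugate. *)
definition universal_lyndon :: "nat \<Rightarrow> nat list \<Rightarrow> bool" where
  "universal_lyndon n w \<longleftrightarrow> w \<in> lists (alphabet n) \<and> length w = fact n \<and>
     (\<forall>v \<in> conjugates w. lyndon n v)"

definition cyclic_factor :: "'a list \<Rightarrow> 'a list \<Rightarrow> bool" where
  "cyclic_factor u w \<longleftrightarrow> u \<noteq> [] \<and> length u \<le> length w \<and> sublist u (w @ w)"

end

theory Submission
  imports Defs "HOL-Combinatorics.Multiset_Permutations"
begin

text \<open>
  There are as many conjugates as orders on the alphabet, so each order makes exactly one conjugate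
  Lyndon and each conjugate is Lyndon for exactly one order. A conjugate starts with the least
  letter of its order. So if two different letters can follow a word z, neither of them lies in z:
  were one of them a letter x of z, the suffix of z beginning with x would start a conjugate with
  least letter x that fails to continue with x although it could.
  As neighbouring letters of an order must be compared somewhere, the order belonging to a
  conjugate is the order of first occurrence of the letters. So if zx occurs with x not in z, then
  zx has exactly (n - |alp(z)| - 1)! cyclic occurrences, and zy occurs as well for every y not in z.

  Sorting the occurrences of sa and sb by the preceding letter y, the words ysa and ysb are equally
  frequent for y different from a and b, while asb does not occur because asa does. Hence bsb occurs
  as often as asa and bsa together.
\<close>

section \<open>Total orders as lists of distinct letters\<close>

primrec precedes :: "'a list \<Rightarrow> 'a \<Rightarrow> 'a \<Rightarrow> bool" where
  "precedes [] x y \<longleftrightarrow> False"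
| "precedes (z # l) x y \<longleftrightarrow> x = z \<and> y \<in> set l \<or> precedes l x y"

lemma precedes_append:
  "precedes (l @ l') x y \<longleftrightarrow> precedes l x y \<or> precedes l' x y \<or> x \<in> set l \<and> y \<in> set l'"
  by (induction l) auto

lemma precedes_in_set: "precedes l x y \<Longrightarrow> x \<in> set l \<and> y \<in> set l"
  by (induction l) auto

lemma precedes_antisym: "distinct l \<Longrightarrow> precedes l x y \<Longrightarrow> \<not> precedes l y x"
  by (induction l) (auto dest: precedes_in_set)

lemma precedes_total: "x \<in> set l \<Longrightarrow> y \<in> set l \<Longrightarrow> x = y \<or> precedes l x y \<or> precedes l y x"
  by (induction l) auto

lemma precedes_sorted_wrt: "sorted_wrt P l \<Longrightarrow> precedes l x y \<Longrightarrow> P x y"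
  by (induction l) auto

lemma precedes_swap:
  "precedes (l @ x # y # l') u v \<Longrightarrow> (u, v) \<noteq> (x, y) \<Longrightarrow> precedes (l @ y # x # l') u v"
  by (auto simp: precedes_append)

lemma not_precedes_hd: "distinct (x # l) \<Longrightarrow> \<not> precedes (x # l) y x"
  using precedes_in_set by fastforce

text \<open>Induction by removing a minimal letter: it exists because \<open>r\<close> restricted to
  a finite set is acyclic, hence well-founded, and totality puts it before all the others.\<close>

lemma strict_linear_order_sorted_list:
  assumes "finite A" "strict_linear_order_on A r"
  obtains l where "l \<in> permutations_of_set A" "sorted_wrt (\<lambda>x y. (x, y) \<in> r) l"
proof -
  have "\<exists>l. set l = B \<and> distinct l \<and> sorted_wrt (\<lambda>x y. (x, y) \<in> r) l" if "finite B" "B \<subseteq> A" for B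
    using that
  proof (induction B rule: finite_psubset_induct)
    case (psubset B)
    show ?case
    proof (cases "B = {}")
      case False
      let ?r = "r \<inter> B \<times> B"
      have "acyclic r"
        using assms(2) by (simp add: strict_linear_order_on_def acyclic_irrefl)
      then have "acyclic ?r"
        by (rule acyclic_subset) auto
      then have "wf ?r"
        using psubset.hyps by (intro finite_acyclic_wf) auto
      then obtain x where x: "x \<in> B" "\<And>y. (y, x) \<in> ?r \<Longrightarrow> y \<notin> B"
        using False by (meson ex_in_conv wfE_min)
      obtain l where l: "set l = B - {x}" "distinct l" "sorted_wrt (\<lambda>x y. (x, y) \<in> r) l"
        using psubset.IH[of "B - {x}"] psubset.prems x(1) by blast
      have "(x, y) \<in> r" if "y \<in> set l" for y
        using assms(2) that l(1) x psubset.prems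
        unfolding strict_linear_order_on_def total_on_def by blast
      then have "sorted_wrt (\<lambda>x y. (x, y) \<in> r) (x # l)"
        using l(3) by simp
      then show ?thesis
        using l x(1) by (intro exI[of _ "x # l"]) auto
    qed (auto intro: exI[of _ "[]"])
  qed
  from this[OF assms(1) order_refl] show ?thesis
    using that by (auto simp: permutations_of_set_def)
qed

text \<open>The conjugate starting at position i is Lyndon for the order listed by l, expressed
  through all comparisons with other conjugates at their first difference.\<close>

definition greedy :: "(nat \<Rightarrow> 'a) \<Rightarrow> 'a list \<Rightarrow> nat \<Rightarrow> bool" where
  "greedy W l i \<longleftrightarrow> (\<forall>j k. (\<forall>t<k. W (j + t) = W (i + t)) \<longrightarrow>
      W (j + k) = W (i + k) \<or> precedes l (W (i + k)) (W (j + k)))"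

lemma greedyD:
  assumes "greedy W l i" "\<And>t. t < k \<Longrightarrow> W (j + t) = W (i + t)" "W (j + k) \<noteq> W (i + k)"
  shows "precedes l (W (i + k)) (W (j + k))"
  using assms(1)[unfolded greedy_def, rule_format, of k j] assms(2,3) by simp

text \<open>At a first difference each position would need its own letter to precede the other's in
  the same list.\<close>

lemma greedy_unique:
  assumes "distinct l" "greedy W l i" "greedy W l j"
  shows "W (i + k) = W (j + k)"
proof (induction k rule: less_induct)
  case (less k)
  show ?case
    using greedyD[OF assms(2), of k j] greedyD[OF assms(3), of k i] less
      precedes_antisym[OF assms(1)] by metis
qed

locale universal_sequence =
  fixes A :: "'a set" and W :: "nat \<Rightarrow> 'a" and m :: nat
  assumes finite_A: "finite A"
    and W_in: "W i \<in> A"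
    and m_def: "m = fact (card A)"
    and W_mod: "W (i mod m) = W i"
    and W_cong: "(\<And>k. W (i + k) = W (j + k)) \<Longrightarrow> i mod m = j mod m"
    and ex_greedy: "\<exists>l\<in>permutations_of_set A. greedy W l i"
begin

section \<open>The bijection between positions and orders\<close>

lemma m_pos: "m > 0"
  by (simp add: m_def)

lemma W_mod_add: "W (i mod m + k) = W (i + k)"
  by (metis W_mod mod_add_left_eq)

lemma greedy_mod_unique:
  assumes "l \<in> permutations_of_set A" "greedy W l i" "greedy W l j"
  shows "i mod m = j mod m"
  by (rule W_cong, rule greedy_unique[OF permutations_of_setD(2)[OF assms(1)] assms(2,3)])

text \<open>An order fits at most one position modulo \<open>m\<close>, so any choice of fitting
  orders is injective on \<open>{..<m}\<close>; as there are exactly \<open>m\<close> orders, it is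
  onto.\<close>

lemma ex_order_of:
  obtains L where "bij_betw L {..<m} (permutations_of_set A)" "\<And>i. greedy W (L i) i"
proof -
  obtain L where L: "\<And>i. L i \<in> permutations_of_set A" "\<And>i. greedy W (L i) i"
    using ex_greedy by metis
  have inj: "inj_on L {..<m}"
    using greedy_mod_unique L by (auto intro!: inj_onI) (metis mod_less)
  have "L ` {..<m} = permutations_of_set A"
    using L(1) card_image[OF inj] finite_A
    by (intro card_subset_eq) (auto simp: m_def)
  with inj have "bij_betw L {..<m} (permutations_of_set A)"
    by (simp add: bij_betw_def)
  with L(2) show ?thesis
    using that by blast
qed

lemma ex_position:
  assumes "l \<in> permutations_of_set A"
  shows "\<exists>i<m. greedy W l i"
proof -
  obtain L where "bij_betw L {..<m} (permutations_of_set A)" and L: "\<And>i. greedy W (L i) i"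
    using ex_order_of by blast
  then obtain i where "i < m" "l = L i"
    using assms by (auto simp: bij_betw_def)
  then show ?thesis
    using L by blast
qed

lemma order_unique:
  assumes "l \<in> permutations_of_set A" "greedy W l i" "l' \<in> permutations_of_set A" "greedy W l' i"
  shows "l = l'"
proof -
  obtain L where bij: "bij_betw L {..<m} (permutations_of_set A)" and L: "\<And>i. greedy W (L i) i"
    using ex_order_of by blast
  \<comment> \<open>By surjectivity \<open>k\<close> is the order chosen for some \<open>j\<close>,
    and an order determines its position modulo \<open>m\<close>.\<close>
  have "k = L (i mod m)" if k: "k \<in> permutations_of_set A" "greedy W k i" for k
  proof -
    obtain j where j: "j < m" "k = L j"
      using bij k(1) by (auto simp: bij_betw_def)
    have "i mod m = j mod m"
      using greedy_mod_unique[OF k] L[of j] j(2) by blast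
    then show ?thesis
      using j by simp
  qed
  then show ?thesis
    using assms by metis
qed

text \<open>If two neighbouring letters of the order were never compared, they could be exchanged.\<close>

lemma ex_branching:
  assumes "l @ x # y # l' \<in> permutations_of_set A" "greedy W (l @ x # y # l') i"
  obtains j k where "\<And>t. t < k \<Longrightarrow> W (j + t) = W (i + t)" "W (i + k) = x" "W (j + k) = y"
proof (rule ccontr)
  note witness = that
  assume "\<not> thesis"
  then have *: "(W (i + k), W (j + k)) \<noteq> (x, y)" if "\<And>t. t < k \<Longrightarrow> W (j + t) = W (i + t)" for j k
    using that witness by blast
  have "greedy W (l @ y # x # l') i"
    unfolding greedy_def
  proof (intro allI impI)
    fix j k assume "\<forall>t<k. W (j + t) = W (i + t)"
    then show "W (j + k) = W (i + k) \<or> precedes (l @ y # x # l') (W (i + k)) (W (j + k))"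
      using greedyD[OF assms(2), of k j] *[of k j] precedes_swap by metis
  qed
  moreover have "l @ y # x # l' \<in> permutations_of_set A"
    using assms(1) by (auto simp: permutations_of_set_def)
  ultimately show False
    using order_unique[OF assms, of "l @ y # x # l'"] assms(1) by (auto simp: permutations_of_set_def)
qed

section \<open>Letters at a branching\<close>

lemma every_letter_occurs:
  assumes "y \<in> A"
  shows "\<exists>k. W (i + k) = y"
proof -
  have "\<exists>j. W j = y"
  proof (cases "A = {y}")
    case True
    then show ?thesis
      using W_in by blast
  next
    case False
    then obtain x where x: "x \<in> A" "x \<noteq> y"
      using assms by blast
    obtain l where l: "set l = A - {x, y}" "distinct l"
      using finite_distinct_list[of "A - {x, y}"] finite_A by auto
    \<comment> \<open>With \<open>y\<close> second in an order headed by \<open>x\<close>, the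
      branching that compares these neighbours exhibits an occurrence of \<open>y\<close>.\<close>
    have perm: "[] @ x # y # l \<in> permutations_of_set A"
      using l x assms by (intro permutations_of_setI) auto
    then obtain i where "greedy W ([] @ x # y # l) i"
      using ex_position by blast
    then show ?thesis
      using ex_branching[OF perm] by metis
  qed
  then obtain j where "W j = y" ..
  \<comment> \<open>A shift by a multiple of the period moves the occurrence at \<open>j\<close> to
    \<open>i\<close> or later.\<close>
  moreover have "i + (j + i * (m - 1)) = j + i * m"
    using m_pos by (cases m) auto
  ultimately show ?thesis
    by (metis W_mod mod_mult_self1 mult.commute)
qed

text \<open>The head of the list occurs at some \<open>j\<close>; if it were not \<open>W i\<close>,
  comparing \<open>i\<close> with \<open>j\<close> at once would make \<open>W i\<close> precede the
  head.\<close>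

lemma hd_order:
  assumes "l \<in> permutations_of_set A" "greedy W l i"
  obtains l' where "l = W i # l'"
proof -
  obtain x l' where l: "l = x # l'"
    using assms(1) W_in[of i] by (cases l) (auto simp: permutations_of_set_def)
  then have "x \<in> A"
    using assms(1) by (auto simp: permutations_of_set_def)
  then obtain j where "W (0 + j) = x"
    using every_letter_occurs by blast
  then have "x = W i"
    using greedyD[OF assms(2), of 0 j] not_precedes_hd[of x l' "W i"] assms(1) l
    by (auto simp: permutations_of_set_def)
  with l show ?thesis
    using that by blast
qed

text \<open>Were the two letters equal, an order fitting \<open>j + t\<close> would be headed by
  this letter, while the branching \<open>k - t\<close> steps later makes \<open>W (j + k)\<close>
  precede it.\<close>

lemma branching_letter_new:
  assumes "\<And>t. t < k \<Longrightarrow> W (j + t) = W (i + t)" "W (j + k) \<noteq> W (i + k)" "t < k"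
  shows "W (i + t) \<noteq> W (i + k)"
proof
  assume eq: "W (i + t) = W (i + k)"
  obtain l where l: "l \<in> permutations_of_set A" "greedy W l (j + t)"
    using ex_greedy by blast
  obtain l' where l': "l = W (j + t) # l'"
    using hd_order[OF l] by blast
  have "precedes l (W (j + t + (k - t))) (W (i + t + (k - t)))"
    using assms by (intro greedyD[OF l(2)]) (auto simp: add.assoc)
  then have "precedes (W (i + k) # l') (W (j + k)) (W (i + k))"
    using assms(1,3) l' eq by auto
  then show False
    using not_precedes_hd l(1) l' eq assms(1,3) by (metis permutations_of_setD(2))
qed

section \<open>Orders as orders of first occurrence\<close>

definition first_occ :: "nat \<Rightarrow> 'a \<Rightarrow> nat" where
  "first_occ i x = (LEAST k. W (i + k) = x)"

lemma W_first_occ: "x \<in> A \<Longrightarrow> W (i + first_occ i x) = x"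
  unfolding first_occ_def by (rule LeastI_ex[OF every_letter_occurs])

lemma first_occ_le: "first_occ i (W (i + k)) \<le> k"
  unfolding first_occ_def by (rule Least_le) simp

lemma first_occ_eqI: "W (i + k) = x \<Longrightarrow> (\<And>t. t < k \<Longrightarrow> W (i + t) \<noteq> x) \<Longrightarrow> first_occ i x = k"
  unfolding first_occ_def by (rule Least_equality) (auto intro: leI)

text \<open>Neighbours \<open>x\<close>, \<open>y\<close> of the list are compared at some
  branching. Both are new there and \<open>i\<close> continues with \<open>x\<close>, so
  \<open>y\<close> comes later; transitivity does the rest.\<close>

lemma sorted_first_occ:
  assumes "l \<in> permutations_of_set A" "greedy W l i"
  shows "sorted_wrt (\<lambda>x y. first_occ i x < first_occ i y) l"
proof -
  have "first_occ i (l ! q) < first_occ i (l ! Suc q)" if q: "Suc q < length l" for q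
  proof -
    define x y where "x = l ! q" and "y = l ! Suc q"
    have l: "l = take q l @ x # y # drop (Suc (Suc q)) l"
      unfolding x_def y_def using q by (metis Cons_nth_drop_Suc Suc_lessD append_take_drop_id)
    then obtain j k where jk: "\<And>t. t < k \<Longrightarrow> W (j + t) = W (i + t)" "W (i + k) = x" "W (j + k) = y"
      using ex_branching assms by metis
    have "distinct l" and "y \<in> A"
      using assms(1) q by (auto simp: permutations_of_set_def y_def)
    then have ne: "x \<noteq> y"
      using q by (simp add: x_def y_def nth_eq_iff_index_eq)
    have x: "first_occ i x = k"
      using jk ne branching_letter_new[of k j i] by (intro first_occ_eqI) auto
    \<comment> \<open>Here the roles of \<open>i\<close> and \<open>j\<close> are exchanged:
      \<open>y\<close> is new for \<open>j\<close>, which reads the same letters as \<open>i\<close>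
      before distance \<open>k\<close>.\<close>
    have y: "W (i + t) \<noteq> y" if "t < k" for t
      using jk ne branching_letter_new[of k i j t] that by auto
    have "k < first_occ i y"
      using y jk(2) ne W_first_occ[OF \<open>y \<in> A\<close>] by (metis linorder_neqE_nat)
    then show ?thesis
      using x by (simp add: x_def y_def)
  qed
  then show ?thesis
    by (subst sorted_wrt_iff_nth_Suc_transp) (auto intro: transpI)
qed

text \<open>At a first difference the letter \<open>u\<close> read from \<open>i\<close> is new and
  no later than \<open>x\<close>, hence in \<open>d\<close>. The order of \<open>i'\<close> puts
  \<open>u'\<close> before \<open>u\<close>, and so does that of \<open>i\<close>, since they agree
  on \<open>d\<close>; but then \<open>u'\<close> was read from \<open>i\<close> already,
  contradicting its newness.\<close>

lemma first_occ_common_prefix: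
  assumes l: "d @ e \<in> permutations_of_set A" "greedy W (d @ e) i"
    and l': "d @ e' \<in> permutations_of_set A" "greedy W (d @ e') i'"
    and x: "x \<in> set d" and "t \<le> first_occ i x"
  shows "W (i' + t) = W (i + t)"
  using assms(6)
proof (induction t rule: less_induct)
  case (less t)
  show ?case
  proof (rule ccontr)
    assume ne: "W (i' + t) \<noteq> W (i + t)"
    define u u' where "u = W (i + t)" and "u' = W (i' + t)"
    have eq: "W (i' + s) = W (i + s)" if "s < t" for s
      using less that by auto
    have u: "first_occ i u = t"
      using branching_letter_new[of t i' i] eq ne by (intro first_occ_eqI) (auto simp: u_def)
    have u': "W (i + s) \<noteq> u'" if "s < t" for s
      using branching_letter_new[of t i i' s] eq ne that by (auto simp: u'_def)
    have "u \<in> set d"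
    proof (rule ccontr)
      assume "u \<notin> set d"
      moreover have "u \<in> set (d @ e)"
        using l(1) W_in by (metis permutations_of_setD(1) u_def)
      ultimately have "first_occ i x < first_occ i u"
        using sorted_first_occ[OF l] x by (auto simp: sorted_wrt_append)
      then show False
        using u less.prems by simp
    qed
    moreover have "precedes (d @ e') u' u"
      unfolding u_def u'_def using eq ne by (intro greedyD[OF l'(2)]) auto
    \<comment> \<open>In the distinct list \<open>d @ e'\<close> only letters of \<open>d\<close>
      precede a letter of \<open>d\<close>.\<close>
    ultimately have "precedes d u' u"
      using l'(1) by (auto simp: precedes_append permutations_of_set_def dest: precedes_in_set)
    then have "precedes (d @ e) u' u"
      by (simp add: precedes_append)
    then have "first_occ i u' < t"
      using precedes_sorted_wrt[OF sorted_first_occ[OF l]] u by blast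
    then show False
      using u' W_first_occ W_in by (metis u'_def)
  qed
qed

section \<open>Counting occurrences of words that end in a new letter\<close>

definition occurs :: "'a list \<Rightarrow> nat \<Rightarrow> bool" where
  "occurs u i \<longleftrightarrow> (\<forall>t<length u. W (i + t) = u ! t)"

definition occs :: "'a list \<Rightarrow> nat set" where
  "occs u = {i. i < m \<and> occurs u i}"

lemma finite_occs [simp]: "finite (occs u)"
  by (simp add: occs_def)

lemma occurs_snoc: "occurs (z @ [x]) i \<longleftrightarrow> (\<forall>t<length z. W (i + t) = z ! t) \<and> W (i + length z) = x"
  by (auto simp: occurs_def nth_append less_Suc_eq)

lemma occurs_Cons: "occurs (x # z) i \<longleftrightarrow> W i = x \<and> occurs z (Suc i)"
  by (auto simp: occurs_def All_less_Suc2)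

lemma occurs_mod: "occurs u (i mod m) \<longleftrightarrow> occurs u i"
  by (simp add: occurs_def W_mod_add)

lemma occs_nonempty: "occurs u i \<Longrightarrow> occs u \<noteq> {}"
  using occurs_mod[of u i] m_pos by (auto simp: occs_def intro: mod_less_divisor)

lemma occurs_unique_extension:
  assumes "occurs (z @ [x]) i" "occurs (z @ [y]) j" "x \<in> set z"
  shows "x = y"
proof (rule ccontr)
  assume "x \<noteq> y"
  obtain t where t: "t < length z" "z ! t = x"
    using assms(3) by (metis in_set_conv_nth)
  show False
    using branching_letter_new[of "length z" j i t] assms(1,2) t \<open>x \<noteq> y\<close>
    by (auto simp: occurs_snoc)
qed

text \<open>The letters of \<open>z\<close> are exactly those first met before \<open>x\<close>, and
  the order lists the letters by first occurrence.\<close>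

lemma order_of_occurrence:
  assumes "l \<in> permutations_of_set A" "greedy W l i" "occurs (z @ [x]) i" "x \<notin> set z"
  obtains d e where "l = d @ x # e" "set d = set z" "first_occ i x = length z"
proof -
  have fo: "first_occ i x = length z"
    using assms(3,4) by (intro first_occ_eqI) (auto simp: occurs_snoc in_set_conv_nth)
  have x: "x \<in> A"
    using assms(3) W_in by (auto simp: occurs_snoc)
  then obtain d e where l: "l = d @ x # e"
    using split_list[of x l] permutations_of_setD(1)[OF assms(1)] by blast
  have A: "A = set d \<union> {x} \<union> set e"
    using assms(1) l by (auto simp: permutations_of_set_def)
  note sorted = sorted_first_occ[OF assms(1,2), unfolded l]
  have z: "y \<in> set z \<longleftrightarrow> first_occ i y < length z" if "y \<in> A" for y
  proof
    assume "y \<in> set z"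
    then obtain t where "t < length z" "z ! t = y"
      by (metis in_set_conv_nth)
    then show "first_occ i y < length z"
      using first_occ_le[of i t] assms(3) by (auto simp: occurs_snoc)
  next
    assume "first_occ i y < length z"
    then have "z ! first_occ i y = y"
      using W_first_occ[OF that, of i] assms(3) by (simp add: occurs_snoc)
    then show "y \<in> set z"
      using \<open>first_occ i y < length z\<close> nth_mem by metis
  qed
  have "set d = set z"
  proof (intro subset_antisym subsetI)
    fix y assume "y \<in> set d"
    then show "y \<in> set z"
      using sorted fo z[of y] A by (auto simp: sorted_wrt_append)
  next
    fix y assume y: "y \<in> set z"
    then obtain t where "t < length z" "z ! t = y"
      by (metis in_set_conv_nth)
    then have "y \<in> A"
      using assms(3) W_in[of "i + t"] by (simp add: occurs_snoc)
    then have "first_occ i y < length z"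
      using y z by simp
    then have "y \<notin> set e"
      using sorted fo by (auto simp: sorted_wrt_append)
    then show "y \<in> set d"
      using \<open>y \<in> A\<close> A y assms(4) by auto
  qed
  with l fo show ?thesis
    using that by blast
qed

text \<open>Moving \<open>y\<close> right behind \<open>x\<close> in the order keeps the prefix up
  to \<open>x\<close>, so the new position still reads \<open>z @ [x]\<close>. The neighbours
  \<open>x\<close> and \<open>y\<close> must be compared there, which can only happen right after
  \<open>z\<close>.\<close>

lemma occurs_new_letter:
  assumes "occurs (z @ [x]) i" "x \<notin> set z" "y \<in> A - set z"
  shows "\<exists>j. occurs (z @ [y]) j"
proof (cases "y = x")
  case False
  obtain l where l: "l \<in> permutations_of_set A" "greedy W l i"
    using ex_greedy by blast
  obtain d e where de: "l = d @ x # e" "set d = set z" "first_occ i x = length z"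
    using order_of_occurrence[OF l assms(1,2)] by blast
  define l' where "l' = d @ x # y # remove1 y e"
  have "y \<in> set e"
    using assms(3) de l(1) False by (auto simp: permutations_of_set_def)
  then have l': "l' \<in> permutations_of_set A"
    using l(1) de(1) unfolding l'_def by (auto simp: permutations_of_set_def)
  then obtain i' where i': "greedy W l' i'"
    using ex_position by blast
  have W_eq: "W (i' + t) = W (i + t)" if "t \<le> length z" for t
    using first_occ_common_prefix[of "d @ [x]" e i "y # remove1 y e" i' x t] l l' i' de that
    by (simp add: l'_def)
  then have "occurs (z @ [x]) i'"
    using assms(1) by (simp add: occurs_snoc)
  then have fo: "first_occ i' x = length z"
    using order_of_occurrence[OF l' i' _ assms(2)] by metis
  obtain j k where jk: "\<And>t. t < k \<Longrightarrow> W (j + t) = W (i' + t)" "W (i' + k) = x" "W (j + k) = y"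
    using ex_branching l' i' unfolding l'_def by metis
  \<comment> \<open>A branching letter is new, so the branching sits at the first \<open>x\<close>,
    at distance \<open>length z\<close>.\<close>
  have "first_occ i' x = k"
    using jk False branching_letter_new[of k j i'] by (intro first_occ_eqI) auto
  then have "occurs (z @ [y]) j"
    using jk fo W_eq assms(1) by (auto simp: occurs_snoc)
  then show ?thesis ..
qed (use assms in blast)

lemma card_permutations_with_prefix:
  assumes "distinct d" "set d \<subseteq> A"
  shows "card {l \<in> permutations_of_set A. \<exists>e. l = d @ e} = fact (card A - length d)"
proof -
  have "{l \<in> permutations_of_set A. \<exists>e. l = d @ e} = (@) d ` permutations_of_set (A - set d)"
    using assms by (auto simp: permutations_of_set_def image_iff)
  then have "card {l \<in> permutations_of_set A. \<exists>e. l = d @ e} = card (permutations_of_set (A - set d))"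
    by (simp add: card_image inj_on_def)
  also have "\<dots> = fact (card A - length d)"
    using assms finite_A by (simp add: card_Diff_subset distinct_card)
  finally show ?thesis .
qed

text \<open>Under the bijection \<open>L\<close> the occurrences correspond to the orders starting
  with \<open>d @ [x]\<close>, where \<open>d\<close> is one fixed arrangement of the letters of
  \<open>z\<close>.\<close>

lemma card_occs_new_letter:
  assumes "occs (z @ [x]) \<noteq> {}" "x \<notin> set z"
  shows "card (occs (z @ [x])) = fact (card A - Suc (card (set z)))"
proof -
  obtain i where i: "occurs (z @ [x]) i"
    using assms(1) by (auto simp: occs_def)
  obtain L where bij: "bij_betw L {..<m} (permutations_of_set A)" and L: "\<And>i. greedy W (L i) i"
    using ex_order_of by blast
  obtain l where l: "l \<in> permutations_of_set A" "greedy W l i"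
    using ex_greedy by blast
  obtain d e where de: "l = d @ x # e" "set d = set z" "first_occ i x = length z"
    using order_of_occurrence[OF l i assms(2)] by blast
  have "occurs (z @ [x]) p \<longleftrightarrow> (\<exists>e. L p = (d @ [x]) @ e)" if "p < m" for p
  proof
    have Lp: "L p \<in> permutations_of_set A"
      using bij that by (auto simp: bij_betw_def)
    {
      assume "\<exists>e. L p = (d @ [x]) @ e"
      then obtain e' where e': "L p = (d @ [x]) @ e'" ..
      have "W (p + t) = W (i + t)" if "t \<le> length z" for t
        using first_occ_common_prefix[of "d @ [x]" e i e' p x t] l Lp L[of p] e' de that by simp
      then show "occurs (z @ [x]) p"
        using i by (simp add: occurs_snoc)
    next
      assume p: "occurs (z @ [x]) p"
      obtain d' e' where d': "L p = d' @ x # e'" "set d' = set z" "first_occ p x = length z"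
        using order_of_occurrence[OF Lp L p assms(2)] by blast
      have W_eq: "W (p + t) = W (i + t)" if "t \<le> length z" for t
        using i p that by (cases "t = length z") (auto simp: occurs_snoc)
      \<comment> \<open>Letters of \<open>z\<close> are first met within the stretch on which
        \<open>p\<close> and \<open>i\<close> agree.\<close>
      have fo: "first_occ p y = first_occ i y" if "y \<in> set z" for y
      proof -
        obtain t where t: "t < length z" "z ! t = y"
          using \<open>y \<in> set z\<close> by (metis in_set_conv_nth)
        have "W (i + t) = y"
          using t i by (simp add: occurs_snoc)
        then have "first_occ i y < length z" "y \<in> A"
          using first_occ_le[of i t] t W_in by auto
        moreover have "W (i + r) \<noteq> y" if "r < first_occ i y" for r
          using first_occ_le[of i r] that by auto
        ultimately show ?thesis
          using W_eq W_first_occ[of y i] by (intro first_occ_eqI) auto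
      qed
      have "sorted_wrt (\<lambda>x y. first_occ i x < first_occ i y) d"
        using sorted_first_occ[OF l] de(1) by (simp add: sorted_wrt_append)
      moreover have "sorted_wrt (\<lambda>x y. first_occ p x < first_occ p y) d'"
        using sorted_first_occ[OF Lp L] d'(1) by (simp add: sorted_wrt_append)
      then have "sorted_wrt (\<lambda>x y. first_occ i x < first_occ i y) d'"
        using fo d'(2) by (metis (no_types, lifting) sorted_wrt_mono_rel)
      \<comment> \<open>Both lists arrange \<open>set z\<close> increasingly by the same key, which
        is injective since a position carries one letter; so they coincide.\<close>
      ultimately have "sorted_wrt (<) (map (first_occ i) d)" "sorted_wrt (<) (map (first_occ i) d')"
        by (simp_all add: sorted_wrt_map)
      then have "map (first_occ i) d = map (first_occ i) d'"
        using de(2) d'(2) by (intro strict_sorted_equal) auto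
      moreover have "inj_on (first_occ i) (set d \<union> set d')"
      proof (rule inj_on_subset)
        show "inj_on (first_occ i) A"
          using W_first_occ by (metis inj_onI)
        show "set d \<union> set d' \<subseteq> A"
          using l(1) de(1,2) d'(2) by (auto simp: permutations_of_set_def)
      qed
      ultimately have "d = d'"
        using map_inj_on by blast
      then show "\<exists>e. L p = (d @ [x]) @ e"
        using d'(1) by auto
    }
  qed
  then have occs_eq: "occs (z @ [x]) = {p \<in> {..<m}. \<exists>e. L p = (d @ [x]) @ e}"
    by (auto simp: occs_def)
  have L_image: "L ` {..<m} = permutations_of_set A"
    using bij by (simp add: bij_betw_def)
  have "L ` occs (z @ [x]) = {l \<in> permutations_of_set A. \<exists>e. l = (d @ [x]) @ e}"
    unfolding occs_eq L_image[symmetric] by blast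
  then have "bij_betw L (occs (z @ [x])) {l \<in> permutations_of_set A. \<exists>e. l = (d @ [x]) @ e}"
    by (intro bij_betw_subset[OF bij]) (auto simp: occs_def)
  then have "card (occs (z @ [x])) = card {l \<in> permutations_of_set A. \<exists>e. l = (d @ [x]) @ e}"
    by (rule bij_betw_same_card)
  also have "\<dots> = fact (card A - length (d @ [x]))"
    using l(1) de(1) by (intro card_permutations_with_prefix) (auto simp: permutations_of_set_def)
  also have "length (d @ [x]) = Suc (card (set z))"
    using l(1) de(1,2) distinct_card[of d] by (simp add: permutations_of_set_def)
  finally show ?thesis .
qed

text \<open>Either both words occur or neither does, and the count of an occurring one depends on
  \<open>z\<close> alone.\<close>

lemma card_occs_eq:
  assumes "x \<in> A - set z" "y \<in> A - set z"
  shows "card (occs (z @ [x])) = card (occs (z @ [y]))"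
proof (cases "occs (z @ [x]) = {}")
  case True
  then have "occs (z @ [y]) = {}"
    using occurs_new_letter[of z y _ x] assms occs_nonempty by (fastforce simp: occs_def)
  with True show ?thesis by simp
next
  case False
  then have "occs (z @ [y]) \<noteq> {}"
    using occurs_new_letter[of z x _ y] assms occs_nonempty by (fastforce simp: occs_def)
  with False show ?thesis
    using card_occs_new_letter assms by simp
qed

section \<open>Sorting occurrences by the preceding letter\<close>

lemma bij_betw_Suc_mod: "bij_betw (\<lambda>p. Suc p mod m) {..<m} {..<m}"
proof -
  have "inj_on (\<lambda>p. Suc p mod m) {..<m}"
    by (rule inj_onI) (auto simp: mod_Suc split: if_splits)
  then show ?thesis
    using m_pos by (intro bij_betw_imageI endo_inj_surj) auto
qed

lemma card_occs_left_extensions: "card (occs u) = (\<Sum>y\<in>A. card (occs (y # u)))"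
proof -
  have "bij_betw (\<lambda>p. Suc p mod m) (\<Union>y\<in>A. occs (y # u)) (occs u)"
  proof -
    have "(\<Union>y\<in>A. occs (y # u)) = {p \<in> {..<m}. occurs u (Suc p mod m)}"
      using W_in by (auto simp: occs_def occurs_Cons occurs_mod)
    moreover have "occs u = {p \<in> {..<m}. occurs u p}"
      by (auto simp: occs_def)
    ultimately show ?thesis
      using bij_betw_Suc_mod by (auto simp: bij_betw_def intro: inj_on_subset)
  qed
  then have "card (occs u) = card (\<Union>y\<in>A. occs (y # u))"
    by (simp add: bij_betw_same_card)
  also have "\<dots> = (\<Sum>y\<in>A. card (occs (y # u)))"
    using finite_A by (intro card_UN_disjoint) (auto simp: occs_def occurs_Cons)
  finally show ?thesis .
qed

lemma occurs_exchange:
  assumes "a \<in> A - set s" "b \<in> A - set s" "occurs (a # s @ [a]) i"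
  shows "\<exists>j. occurs (b # s @ [b]) j"
proof (cases "a = b")
  case False
  \<comment> \<open>The first argument of \<open>f\<close> is the last letter of the word, the
    second one its first letter.\<close>
  define f where "f x y = card (occs (y # s @ [x]))" for x y
  have "(\<Sum>y\<in>A. f a y) = (\<Sum>y\<in>A. f b y)"
    using card_occs_eq[OF assms(1,2)] card_occs_left_extensions[of "s @ [a]"]
      card_occs_left_extensions[of "s @ [b]"] by (simp add: f_def)
  then have "f a a + (f a b + (\<Sum>y\<in>A - {a} - {b}. f a y)) = f b a + (f b b + (\<Sum>y\<in>A - {a} - {b}. f b y))"
    using assms(1,2) False finite_A by (simp add: sum.remove[of A a] sum.remove[of "A - {a}" b])
  \<comment> \<open>For these \<open>y\<close> both \<open>a\<close> and \<open>b\<close> are new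
    after \<open>y # s\<close>.\<close>
  moreover have "(\<Sum>y\<in>A - {a} - {b}. f a y) = (\<Sum>y\<in>A - {a} - {b}. f b y)"
    using assms(1,2) card_occs_eq[of a "_ # s" b] by (intro sum.cong) (auto simp: f_def)
  \<comment> \<open>The word \<open>a # s\<close> contains \<open>a\<close> and is followed by it
    once, hence always.\<close>
  moreover have "f b a = 0"
    using occurs_unique_extension[of "a # s" a i b] assms(3) False by (auto simp: f_def occs_def)
  moreover have "f a a > 0"
    using occs_nonempty[OF assms(3)] by (simp add: f_def card_gt_0_iff)
  ultimately have "f b b > 0"
    by linarith
  then show ?thesis
    by (auto simp: f_def card_gt_0_iff occs_def)
qed (use assms(3) in auto)

end

section \<open>From words to periodic sequences\<close>

definition cyclic_nth :: "'a list \<Rightarrow> nat \<Rightarrow> 'a" where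
  "cyclic_nth w i = w ! (i mod length w)"

lemma nth_rotate_cyclic: "k < length w \<Longrightarrow> rotate i w ! k = cyclic_nth w (i + k)"
  by (simp add: cyclic_nth_def nth_rotate)

lemma cyclic_factor_iff:
  assumes "w \<noteq> []"
  shows "cyclic_factor u w \<longleftrightarrow> u \<noteq> [] \<and> length u \<le> length w \<and>
    (\<exists>i. \<forall>t<length u. cyclic_nth w (i + t) = u ! t)"
proof -
  have ww: "(w @ w) ! q = cyclic_nth w q" if "q < 2 * length w" for q
    using that by (auto simp: cyclic_nth_def nth_append not_less le_mod_geq)
  have "sublist u (w @ w) \<longleftrightarrow> (\<exists>i. \<forall>t<length u. cyclic_nth w (i + t) = u ! t)"
    if u: "length u \<le> length w"
  proof
    assume "sublist u (w @ w)"
    then obtain p q where pq: "w @ w = p @ u @ q"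
      by (auto simp: sublist_def)
    then have "length p + length u \<le> 2 * length w"
      by (metis add.assoc length_append le_add1 mult_2)
    then have "cyclic_nth w (length p + t) = u ! t" if "t < length u" for t
      using ww[of "length p + t"] that pq by (simp add: nth_append)
    then show "\<exists>i. \<forall>t<length u. cyclic_nth w (i + t) = u ! t"
      by blast
  next
    assume "\<exists>i. \<forall>t<length u. cyclic_nth w (i + t) = u ! t"
    then obtain i where i: "\<And>t. t < length u \<Longrightarrow> cyclic_nth w (i + t) = u ! t"
      by blast
    \<comment> \<open>From a start in the first copy of \<open>w\<close>, a window of length at most
      \<open>length w\<close> stays inside \<open>w @ w\<close>.\<close>
    define j where "j = i mod length w"
    have j: "j < length w"
      using assms by (simp add: j_def)
    have "u = take (length u) (drop j (w @ w))"
    proof (rule nth_equalityI)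
      fix t assume t: "t < length u"
      have "take (length u) (drop j (w @ w)) ! t = (w @ w) ! (j + t)"
        using t u j by (simp del: drop_append)
      also have "\<dots> = cyclic_nth w (j + t)"
        using t u j by (intro ww) simp
      also have "\<dots> = u ! t"
        using i[OF t] by (simp add: cyclic_nth_def j_def mod_add_left_eq)
      finally show "u ! t = take (length u) (drop j (w @ w)) ! t" ..
    qed (use u j in simp)
    then show "sublist u (w @ w)"
      by (metis sublist_drop sublist_order.order_trans sublist_take)
  qed
  then show ?thesis
    by (auto simp: cyclic_factor_def)
qed

lemma rotate_proper_conjugate:
  assumes "w \<noteq> []" "i mod length w \<noteq> j mod length w"
  shows "rotate j w \<in> proper_conjugates (rotate i w)"
proof -
  let ?m = "length w"
  \<comment> \<open>This is \<open>j - i\<close> modulo the length, arranged to avoid truncated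
    subtraction.\<close>
  define d where "d = (j + (?m - i mod ?m)) mod ?m"
  have le: "i mod ?m \<le> ?m" "?m > 0"
    using assms(1) by (auto intro: less_imp_le)
  have "(d + i) mod ?m = (j + (?m - i mod ?m) + i mod ?m) mod ?m"
    unfolding d_def by (metis mod_add_left_eq mod_add_right_eq)
  also have "\<dots> = j mod ?m"
    using le(1) by simp
  finally have d: "(d + i) mod ?m = j mod ?m" .
  have "d \<noteq> 0"
    using d assms(2) by (metis add_0)
  moreover have "d < ?m"
    using le by (simp add: d_def)
  moreover have "rotate j w = rotate d (rotate i w)"
    using d by (simp add: rotate_rotate rotate_conv_mod[of j] rotate_conv_mod[of "d + i"])
  moreover have "rotate d (rotate i w) = drop d (rotate i w) @ take d (rotate i w)"
    using \<open>d < ?m\<close> by (simp add: rotate_drop_take)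
  ultimately have "\<exists>w1 w2. rotate j w = w2 @ w1 \<and> rotate i w = w1 @ w2 \<and> w1 \<noteq> [] \<and> w2 \<noteq> []"
    using assms(1)
    by - (rule exI[of _ "take d (rotate i w)"], rule exI[of _ "drop d (rotate i w)"], simp)
  then show ?thesis
    by (simp add: proper_conjugates_def)
qed

lemma universal_lyndon_sequence:
  assumes "universal_lyndon n w"
  shows "universal_sequence (alphabet n) (cyclic_nth w) (length w)"
proof
  have len: "length w = fact n" and w: "w \<in> lists (alphabet n)"
    using assms by (auto simp: universal_lyndon_def)
  then have pos: "length w > 0"
    by simp
  show "finite (alphabet n)" "length w = fact (card (alphabet n))"
    using len by (auto simp: alphabet_def)
  show "cyclic_nth w i \<in> alphabet n" for i
    using w pos by (auto simp: cyclic_nth_def in_lists_conv_set)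
  show "cyclic_nth w (i mod length w) = cyclic_nth w i" for i
    by (simp add: cyclic_nth_def)
  have order: "\<exists>r. strict_linear_order_on (alphabet n) r \<and>
      (\<forall>j. i mod length w \<noteq> j mod length w \<longrightarrow> (rotate i w, rotate j w) \<in> lexord r)" for i
  proof -
    have "rotate i w \<in> conjugates w"
      unfolding conjugates_def rotate_drop_take
      by (intro CollectI, rule exI[of _ "take (i mod length w) w"],
          rule exI[of _ "drop (i mod length w) w"]) simp
    then have "lyndon n (rotate i w)"
      using assms by (auto simp: universal_lyndon_def)
    then show ?thesis
      unfolding lyndon_def using rotate_proper_conjugate[of w i] pos by auto
  qed
  \<comment> \<open>Otherwise a rotation of \<open>w\<close> would be strictly smaller than
    itself.\<close>
  show "i mod length w = j mod length w"
    if eq: "\<And>k. cyclic_nth w (i + k) = cyclic_nth w (j + k)" for i j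
  proof (rule ccontr)
    assume ne: "i mod length w \<noteq> j mod length w"
    obtain r where r: "strict_linear_order_on (alphabet n) r" "(rotate i w, rotate j w) \<in> lexord r"
      using order[of i] ne by blast
    have "rotate i w = rotate j w"
      by (rule nth_equalityI) (auto simp: nth_rotate_cyclic eq)
    then show False
      using r lexord_irreflexive[of r] by (auto simp: strict_linear_order_on_def irrefl_def)
  qed
  show "\<exists>l\<in>permutations_of_set (alphabet n). greedy (cyclic_nth w) l i" for i
  proof -
    obtain r where r: "strict_linear_order_on (alphabet n) r"
      "\<And>j. i mod length w \<noteq> j mod length w \<Longrightarrow> (rotate i w, rotate j w) \<in> lexord r"
      using order[of i] by blast
    obtain l where l: "l \<in> permutations_of_set (alphabet n)" "sorted_wrt (\<lambda>x y. (x, y) \<in> r) l"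
      using strict_linear_order_sorted_list[OF _ r(1)] by (metis alphabet_def finite_atLeastAtMost)
    have "irrefl r" "trans r"
      using r(1) by (auto simp: strict_linear_order_on_def)
    have in_l: "cyclic_nth w k \<in> set l" for k
      using l(1) w pos by (auto simp: permutations_of_set_def cyclic_nth_def in_lists_conv_set)
    have "precedes l (cyclic_nth w (i + k)) (cyclic_nth w (j + k))"
      if eq: "\<And>t. t < k \<Longrightarrow> cyclic_nth w (j + t) = cyclic_nth w (i + t)"
        and ne: "cyclic_nth w (j + k) \<noteq> cyclic_nth w (i + k)" for j k
    proof -
      have "i mod length w \<noteq> j mod length w"
        using ne by (metis cyclic_nth_def mod_add_left_eq)
      then have "(rotate i w, rotate j w) \<in> lexord r"
        by (rule r(2))
      \<comment> \<open>Rotations have equal length, so the proper prefix case of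
        \<open>lexord\<close> cannot arise.\<close>
      then obtain p where p: "p < length w" "take p (rotate i w) = take p (rotate j w)"
        "(rotate i w ! p, rotate j w ! p) \<in> r"
        by (auto simp: lexord_take_index_conv)
      have eq': "cyclic_nth w (i + t) = cyclic_nth w (j + t)" if "t < p" for t
        using p(1,2) that by (metis nth_rotate_cyclic nth_take order.strict_trans)
      have rp: "(cyclic_nth w (i + p), cyclic_nth w (j + p)) \<in> r"
        using p by (simp add: nth_rotate_cyclic)
      \<comment> \<open>Both are the place of the first difference; at \<open>p\<close> the letters
        differ by irreflexivity.\<close>
      have "p = k"
        using eq[of p] eq'[of k] ne rp \<open>irrefl r\<close> by (metis irrefl_def linorder_neqE_nat)
      then have "(cyclic_nth w (i + k), cyclic_nth w (j + k)) \<in> r"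
        using rp by simp
      then have "\<not> precedes l (cyclic_nth w (j + k)) (cyclic_nth w (i + k))"
        using precedes_sorted_wrt[OF l(2)] \<open>irrefl r\<close> \<open>trans r\<close> by (metis irrefl_def transD)
      then show ?thesis
        using precedes_total[OF in_l in_l] ne by metis
    qed
    then show ?thesis
      using l(1) unfolding greedy_def by metis
  qed
qed

theorem theorem3:
  fixes n :: nat and w s :: "nat list" and a :: nat
  assumes "universal_lyndon n w"
    and "s \<in> lists (alphabet n)"
    and "a \<in> alphabet n - set s"
    and "cyclic_factor ([a] @ s @ [a]) w"
  shows "\<forall>b \<in> alphabet n - set s. cyclic_factor ([b] @ s @ [b]) w"
proof
  fix b assume b: "b \<in> alphabet n - set s"
  interpret universal_sequence "alphabet n" "cyclic_nth w" "length w"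
    using assms(1) by (rule universal_lyndon_sequence)
  have w: "w \<noteq> []"
    using m_pos by simp
  have "\<exists>i. occurs (a # s @ [a]) i"
    using assms(4) by (simp add: cyclic_factor_iff[OF w] occurs_def)
  then have "\<exists>j. occurs (b # s @ [b]) j"
    using occurs_exchange[OF assms(3) b] by blast
  \<comment> \<open>The length bound carries over, as both words have the same length.\<close>
  then show "cyclic_factor ([b] @ s @ [b]) w"
    using assms(4) by (simp add: cyclic_factor_iff[OF w] occurs_def)
qed

end
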